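(* Let $\Omega$ be an infinite set. Let $f:\Omega\to\Omega$ be surjective and let $\Omega_f$ be a cofinite and proper subset of $\Omega$. If $g:\Omega\to\Omega$ is injective, then $g\not\equiv f$.
   Context: A subset $A\subseteq\Omega$ is cofinite if $\Omega\setminus A$ is finite. For self-maps $f,g$ of $\Omega$, $f\equiv g$ (almost equal) means that $\{\omega\in\Omega: f(\omega)\neq g(\omega)\}$ is finite. The monoset of $f$ is $\Omega_f=\{\omega\in\Omega:\ f^{-1}(\{f(\omega)\})=\{\omega\}\}$, where $f^{-1}(B)$ denotes the preimage of $B$. *)

theory Defs
  imports Main "HOL-Library.FuncSet"
begin

text \<open>
  The ground set is an explicit carrier \<open>\<Omega>\<close>. A self-map of \<open>\<Omega>\<close> is a total function \<open>f\<close> of the logic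
  with \<open>f \<in> \<Omega> \<rightarrow> \<Omega>\<close>; its values outside \<open>\<Omega>\<close> are irrelevant, so all notions below are relative
  to \<open>\<Omega>\<close>.
\<close>

definition cofinite_in :: "'a set \<Rightarrow> 'a set \<Rightarrow> bool" where
  "cofinite_in \<Omega> A \<longleftrightarrow> A \<subseteq> \<Omega> \<and> finite (\<Omega> - A)"

definition almost_equal :: "'a set \<Rightarrow> ('a \<Rightarrow> 'a) \<Rightarrow> ('a \<Rightarrow> 'a) \<Rightarrow> bool" where
  "almost_equal \<Omega> f g \<longleftrightarrow> finite {\<omega> \<in> \<Omega>. f \<omega> \<noteq> g \<omega>}"

definition monoset :: "'a set \<Rightarrow> ('a \<Rightarrow> 'a) \<Rightarrow> 'a set" where
  "monoset \<Omega> f = {\<omega> \<in> \<Omega>. f -` {f \<omega>} \<inter> \<Omega> = {\<omega>}}"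

end

theory Submission
  imports Defs
begin

text \<open>
  The argument compares how many points \<open>f\<close> and \<open>g\<close> can produce from one finite set \<open>F\<close>, namely the
  points outside the monoset together with those where \<open>f\<close> and \<open>g\<close> differ; it is finite if \<open>g\<close> is
  almost equal to \<open>f\<close>. As \<open>g\<close> is injective and agrees with \<open>f\<close> outside \<open>F\<close>, no value of \<open>g\<close> on \<open>F\<close>
  is taken by \<open>f\<close> outside \<open>F\<close>; since \<open>f\<close> is surjective, \<open>f\<close> must then take all these values on \<open>F\<close>
  itself (\<open>image_subset_if_inj_on_and_agree_outside\<close>), and
  \<open>card F = card (g ` F) \<le> card (f ` F)\<close>. But \<open>F\<close> contains two points that \<open>f\<close> identifies: one
  exists outside the monoset, and its partner lies outside the monoset as well
  (\<open>not_inj_on_superset_compl_monoset\<close>).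
\<close>

lemma monosetD:
  assumes "x \<in> monoset \<Omega> f" "y \<in> \<Omega>" "f y = f x"
  shows "y = x"
  using assms unfolding monoset_def by blast

text \<open>Failing to lie in the monoset is symmetric in the two points of a collision, so a set that
  contains all such points contains entire collisions.\<close>

lemma not_inj_on_superset_compl_monoset:
  assumes "monoset \<Omega> f \<subset> \<Omega>" and "\<Omega> - monoset \<Omega> f \<subseteq> F"
  shows "\<not> inj_on f F"
proof -
  obtain x where x: "x \<in> \<Omega>" "x \<notin> monoset \<Omega> f"
    using assms(1) by blast
  then obtain y where y: "y \<in> \<Omega>" "f y = f x" "y \<noteq> x"
    unfolding monoset_def by blast
  have "y \<notin> monoset \<Omega> f"
    using monosetD[of y \<Omega> f x] x(1) y by auto
  then have "x \<in> F" "y \<in> F"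
    using assms(2) x y(1) by blast+
  then show ?thesis
    using y(2,3) by (auto dest: inj_onD)
qed

text \<open>Surjectivity puts each value \<open>g x\<close> in the image of \<open>f\<close>; a preimage outside \<open>F\<close> would be a second
  point with the same value under \<open>g\<close>.\<close>

lemma image_subset_if_inj_on_and_agree_outside:
  assumes "F \<subseteq> \<Omega>" and "g \<in> \<Omega> \<rightarrow> \<Omega>" and "inj_on g \<Omega>" and "f ` \<Omega> = \<Omega>"
    and agree: "\<And>x. x \<in> \<Omega> - F \<Longrightarrow> g x = f x"
  shows "g ` F \<subseteq> f ` F"
proof
  fix v assume "v \<in> g ` F"
  then obtain x where x: "x \<in> F" "v = g x" by blast
  then have "x \<in> \<Omega>" "v \<in> f ` \<Omega>"
    using assms(1,2,4) by auto
  then obtain y where y: "y \<in> \<Omega>" "v = f y" by blast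
  have "y \<in> F"
  proof (rule ccontr)
    assume "y \<notin> F"
    then have "g y = g x" using agree y x(2) by simp
    then have "y = x" using inj_onD[OF assms(3)] y(1) \<open>x \<in> \<Omega>\<close> by blast
    then show False using \<open>y \<notin> F\<close> x(1) by simp
  qed
  then show "v \<in> f ` F" using y(2) by blast
qed

theorem theorem5:
  fixes \<Omega> :: "'a set" and f g :: "'a \<Rightarrow> 'a"
  assumes "infinite \<Omega>"
    and "f \<in> \<Omega> \<rightarrow> \<Omega>" and "f ` \<Omega> = \<Omega>"
    and "cofinite_in \<Omega> (monoset \<Omega> f)" and "monoset \<Omega> f \<subset> \<Omega>"
    and "g \<in> \<Omega> \<rightarrow> \<Omega>" and "inj_on g \<Omega>"
  shows "\<not> almost_equal \<Omega> g f"
proof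
  assume "almost_equal \<Omega> g f"
  define F where "F = (\<Omega> - monoset \<Omega> f) \<union> {\<omega> \<in> \<Omega>. g \<omega> \<noteq> f \<omega>}"
  have fin: "finite F"
    using \<open>almost_equal \<Omega> g f\<close> assms(4)
    unfolding F_def almost_equal_def cofinite_in_def by simp
  have F: "F \<subseteq> \<Omega>" "\<Omega> - monoset \<Omega> f \<subseteq> F"
    unfolding F_def by auto
  have "g ` F \<subseteq> f ` F"
    using F(1) assms(6,7,3)
    by (rule image_subset_if_inj_on_and_agree_outside) (simp add: F_def)
  then have "card (g ` F) \<le> card (f ` F)"
    using fin by (simp add: card_mono)
  moreover have "card (g ` F) = card F"
    using inj_on_subset[OF assms(7) F(1)] by (rule card_image)
  ultimately have "card (f ` F) = card F"
    using card_image_le[OF fin, of f] by simp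
  then have "inj_on f F"
    using fin by (simp add: eq_card_imp_inj_on)
  then show False
    using not_inj_on_superset_compl_monoset[OF assms(5) F(2)] by simp
qed

end
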